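(* For integers $n\ge2$ let $M_n^T(s)=\int_0^1x^{s-1}T_n(x)(1-x^2)^{1/2}dx$ ($\Re s>0$), with $T_n$ the Chebyshev polynomial of the first kind, let $\varepsilon=0$ for $n$ even and $\varepsilon=1$ for $n$ odd, and define $p_n^T(s)=M_n^T(s)\,\Gamma\left(\frac{s+n+3}{2}\right)/\Gamma\left(\frac{s+\varepsilon}{2}\right)$. Then $p_n^T(s)$ is a polynomial in $s$ whose zeros are: for $n$ odd, the even integers $2,4,\dots,n-3$ together with $n^2-1$; for $n$ even, the odd integers $1,3,\dots,n-3$ together with $n^2-1$ (for $n=2,3$ the only zero is $n^2-1$).
   Context: $T_n(\cos\theta)=\cos(n\theta)$. *)

theory Defs
  imports "HOL-Analysis.Analysis" "HOL-Computational_Algebra.Polynomial"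
begin

text \<open>The polynomial is determined by its values on \<open>[-1, 1]\<close>; existence and
  uniqueness are proved below, so the definite description is never vacuous.\<close>

definition chebyshev_T :: "nat \<Rightarrow> real poly" where
  "chebyshev_T n = (THE p. \<forall>\<theta>::real. poly p (cos \<theta>) = cos (real n * \<theta>))"

lemma chebyshev_T_exists:
  "\<exists>p::real poly. \<forall>\<theta>::real. poly p (cos \<theta>) = cos (real n * \<theta>)"
proof (induction n rule: less_induct)
  case (less n)
  consider "n = 0" | "n = 1" | m where "n = Suc (Suc m)"
    using that by (cases n; cases "n - 1") auto
  then show ?case
  proof cases
    case 1
    then show ?thesis by (intro exI[of _ 1]) simp
  next
    case 2
    then show ?thesis by (intro exI[of _ "[:0, 1:]"]) simp
  next
    case 3
    obtain p where p: "\<forall>\<theta>::real. poly p (cos \<theta>) = cos (real m * \<theta>)"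
      using less.IH[of m] 3 by auto
    obtain q where q: "\<forall>\<theta>::real. poly q (cos \<theta>) = cos (real (Suc m) * \<theta>)"
      using less.IH[of "Suc m"] 3 by auto
    have "poly ([:0, 2:] * q - p) (cos \<theta>) = cos (real n * \<theta>)" for \<theta> :: real
    proof -
      have "cos (real n * \<theta>) = cos (real (Suc m) * \<theta> + \<theta>)"
        using 3 by (simp add: algebra_simps)
      moreover have "cos (real m * \<theta>) = cos (real (Suc m) * \<theta> - \<theta>)"
        by (simp add: algebra_simps)
      ultimately show ?thesis
        using p q by (simp only: cos_add cos_diff poly_diff poly_mult) simp
    qed
    then show ?thesis by blast
  qed
qed

lemma chebyshev_T_unique:
  fixes p q :: "real poly"
  assumes "\<forall>\<theta>::real. poly p (cos \<theta>) = cos (real n * \<theta>)"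
    and "\<forall>\<theta>::real. poly q (cos \<theta>) = cos (real n * \<theta>)"
  shows "p = q"
proof (rule ccontr)
  assume "p \<noteq> q"
  then have "finite {x. poly (p - q) x = 0}"
    by (intro poly_roots_finite) simp
  moreover have "{-1..1} \<subseteq> {x. poly (p - q) x = 0}"
  proof
    fix x :: real
    assume "x \<in> {-1..1}"
    then have "cos (arccos x) = x" by simp
    moreover have "poly (p - q) (cos (arccos x)) = 0"
      using assms by (simp only: poly_diff diff_self)
    ultimately show "x \<in> {x. poly (p - q) x = 0}"
      by simp
  qed
  ultimately have "finite {-1..1::real}"
    using finite_subset by blast
  then show False by (simp add: infinite_Icc)
qed

lemma poly_chebyshev_T_cos:
  "poly (chebyshev_T n) (cos \<theta>) = cos (real n * \<theta>)"
proof -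
  have "\<exists>!p::real poly. \<forall>\<theta>::real. poly p (cos \<theta>) = cos (real n * \<theta>)"
    using chebyshev_T_exists[of n] chebyshev_T_unique[of _ n] by blast
  from theI'[OF this] show ?thesis
    unfolding chebyshev_T_def by blast
qed

text \<open>At \<open>x = 0\<close> the library sets \<open>0 powr z = 0\<close>; this single point
  does not affect the integral.\<close>

definition mellin_T :: "nat \<Rightarrow> complex \<Rightarrow> complex" where
  "mellin_T n s = integral {0..1::real}
     (\<lambda>x. of_real x powr (s - 1) * of_real (poly (chebyshev_T n) x * (1 - x\<^sup>2) powr (1/2)))"

definition parity_eps :: "nat \<Rightarrow> nat" where
  "parity_eps n = (if even n then 0 else 1)"

definition p_T :: "nat \<Rightarrow> complex \<Rightarrow> complex" where
  "p_T n s = mellin_T n s * Gamma ((s + of_nat n + 3) / 2)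
               / Gamma ((s + of_nat (parity_eps n)) / 2)"

end

theory Submission
  imports Defs "HOL-Complex_Analysis.Complex_Analysis"
begin

text \<open>The substitution \<open>t = x\<^sup>2\<close> turns \<open>M\<^sub>0(s)\<close> for real \<open>s > 0\<close> into the Beta integral
  \<open>B(s/2, 3/2) / 2\<close>, and analytic continuation extends this to \<open>Re s > 0\<close>; hence
  \<open>p\<^sub>0 = p\<^sub>1 = \<Gamma>(3/2) / 2\<close>. The Chebyshev recurrence gives
  \<open>M\<^sub>n\<^sub>+\<^sub>2(s) = 2 M\<^sub>n\<^sub>+\<^sub>1(s + 1) - M\<^sub>n(s)\<close>, that is
  \<open>p\<^sub>n\<^sub>+\<^sub>2(s) = \<sigma> p\<^sub>n\<^sub>+\<^sub>1(s + 1) - (s + n + 3) / 2 * p\<^sub>n(s)\<close> with \<open>\<sigma> = s\<close> for even \<open>n\<close> and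
  \<open>\<sigma> = 2\<close> for odd \<open>n\<close>. The shift \<open>s \<mapsto> s + 1\<close> carries the trivial zeros of \<open>p\<^sub>n\<^sub>+\<^sub>1\<close> to those of
  \<open>p\<^sub>n\<close> (together with \<open>0\<close> if \<open>n\<close> is odd), so the factorised form propagates by induction.\<close>

section \<open>Three-term recurrence of the Chebyshev polynomials\<close>

lemma chebyshev_T_0: "chebyshev_T 0 = 1"
  by (rule chebyshev_T_unique[where n = 0]) (auto simp: poly_chebyshev_T_cos)

lemma chebyshev_T_1: "chebyshev_T 1 = [:0, 1:]"
  by (rule chebyshev_T_unique[where n = 1]) (auto simp: poly_chebyshev_T_cos)

lemma chebyshev_T_rec: "chebyshev_T (n + 2) = [:0, 2:] * chebyshev_T (n + 1) - chebyshev_T n"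
proof (rule chebyshev_T_unique[where n = "n + 2"]; intro allI)
  fix \<theta> :: real
  have 1: "cos (real (n + 2) * \<theta>) = cos (real (n + 1) * \<theta> + \<theta>)"
    by (simp add: algebra_simps)
  have 2: "cos (real n * \<theta>) = cos (real (n + 1) * \<theta> - \<theta>)"
    by (simp add: algebra_simps)
  show "poly ([:0, 2:] * chebyshev_T (n + 1) - chebyshev_T n) (cos \<theta>) = cos (real (n + 2) * \<theta>)"
    unfolding poly_diff poly_mult poly_chebyshev_T_cos 1 2 cos_add cos_diff by simp
qed (rule poly_chebyshev_T_cos)

section \<open>Convergence and recurrence of the Mellin integrals\<close>

text \<open>A bound \<open>B\<close> for \<open>g\<close> on the compact interval gives the majorant
  B x^(Re s - 1), whose exponent exceeds -1.\<close>

lemma powr_continuous_absolutely_integrable: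
  fixes g :: "real \<Rightarrow> complex"
  assumes g: "continuous_on {0..1} g" and s: "Re s > 0"
  shows "(\<lambda>x. of_real x powr (s - 1) * g x) absolutely_integrable_on {0..1}"
proof -
  have "bounded (g ` {0..1})"
    using g by (intro compact_imp_bounded compact_continuous_image) auto
  then obtain B where B: "\<And>x. x \<in> {0..1} \<Longrightarrow> norm (g x) \<le> B"
    unfolding bounded_iff by blast
  have int: "(\<lambda>x. x powr (Re s - 1) * B) integrable_on {0..1}"
    using integrable_on_powr_from_0[of "Re s - 1" 1] s by (intro integrable_on_mult_left) auto
  \<comment> \<open>The endpoint 0, where the power may fail to be continuous, is left out and
    restored at the end as a null set.\<close>
  have "(\<lambda>x. complex_of_real x powr (s - 1) * g x) absolutely_integrable_on {0<..1}"
  proof (rule measurable_bounded_by_integrable_imp_absolutely_integrable)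
    show "(\<lambda>x. complex_of_real x powr (s - 1) * g x) \<in> borel_measurable (lebesgue_on {0<..1})"
    proof (rule continuous_imp_measurable_on_sets_lebesgue)
      have "continuous_on {0<..1} g"
        by (rule continuous_on_subset[OF g]) auto
      then show "continuous_on {0<..1} (\<lambda>x. complex_of_real x powr (s - 1) * g x)"
        by (intro continuous_intros) auto
    qed auto
    show "(\<lambda>x. x powr (Re s - 1) * B) integrable_on {0<..1}"
      by (rule integrable_spike_set[OF int]) (auto intro: negligible_subset[of "{0}"])
    fix x :: real assume "x \<in> {0<..1}"
    then show "norm (complex_of_real x powr (s - 1) * g x) \<le> x powr (Re s - 1) * B"
      using B[of x] by (auto simp: norm_mult norm_powr_real_powr intro!: mult_left_mono)
  qed auto
  then show ?thesis
    by (rule absolutely_integrable_spike_set) (auto intro: negligible_subset[of "{0}"])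
qed

definition mellin_integrand :: "nat \<Rightarrow> complex \<Rightarrow> real \<Rightarrow> complex" where
  "mellin_integrand n s = (\<lambda>x. of_real x powr (s - 1) *
     of_real (poly (chebyshev_T n) x * (1 - x\<^sup>2) powr (1/2)))"

lemma mellin_integrand_integrable:
  assumes "Re s > 0" shows "mellin_integrand n s absolutely_integrable_on {0..1}"
  unfolding mellin_integrand_def using assms
  by (intro powr_continuous_absolutely_integrable continuous_intros continuous_on_powr') (auto simp: power_le_one)

lemma mellin_integrand_has_integral:
  assumes "Re s > 0" shows "(mellin_integrand n s has_integral mellin_T n s) {0..1}"
  using set_lebesgue_integral_eq_integral(1)[OF mellin_integrand_integrable[OF assms, of n]]
  unfolding mellin_T_def by (simp add: mellin_integrand_def has_integral_iff)

text \<open>Turns a factor x from a Chebyshev polynomial into the shift from s to s + 1. At x = 0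
  both sides vanish because of the convention \<open>0 powr z = 0\<close>.\<close>

lemma powr_of_real_eq_mult: "of_real x powr s = of_real x * of_real x powr (s - 1)" for x :: real and s :: complex
  by (cases "x = 0") (auto simp: powr_diff)

lemma mellin_T_rec:
  assumes s: "Re s > 0"
  shows "mellin_T (n + 2) s = 2 * mellin_T (n + 1) (s + 1) - mellin_T n s"
proof (rule has_integral_unique)
  show "(mellin_integrand (n+2) s has_integral mellin_T (n + 2) s) {0..1}"
    using s by (intro mellin_integrand_has_integral) auto
  have "((\<lambda>x. 2 * mellin_integrand (n+1) (s+1) x - mellin_integrand n s x) has_integral
     (2 * mellin_T (n + 1) (s + 1) - mellin_T n s)) {0..1}"
    using s by (intro has_integral_diff has_integral_mult_right mellin_integrand_has_integral) auto
  moreover have "(\<lambda>x. 2 * mellin_integrand (n+1) (s+1) x - mellin_integrand n s x) = mellin_integrand (n+2) s"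
    unfolding mellin_integrand_def chebyshev_T_rec by (rule ext) (simp add: powr_of_real_eq_mult[of _ s] algebra_simps)
  ultimately show "(mellin_integrand (n+2) s has_integral (2 * mellin_T (n + 1) (s + 1) - mellin_T n s)) {0..1}"
    by simp
qed

lemma mellin_T_1: "mellin_T 1 s = mellin_T 0 (s + 1)"
  unfolding mellin_T_def chebyshev_T_0 chebyshev_T_1 by (simp add: powr_of_real_eq_mult[of _ s] mult_ac)

section \<open>Closed form of the integral for n = 0\<close>

lemma mellin_T_0_real:
  assumes s: "s > 0"
  shows "mellin_T 0 (of_real s) = of_real (Beta (s / 2) (3 / 2) / 2)"
proof -
  define f where "f = (\<lambda>t::real. t powr (s / 2 - 1) * (1 - t) powr (1 / 2))"
  have f01: "(f has_integral Beta (s / 2) (3 / 2)) {0..1}"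
    using has_integral_Beta_real[of "s / 2" "3 / 2"] s by (simp add: f_def)
  \<comment> \<open>Nonnegativity upgrades integrability to the absolute integrability required by
    the change of variables.\<close>
  have "f absolutely_integrable_on {0..1}"
    using f01 by (intro nonnegative_absolutely_integrable_1) (auto simp: f_def)
  then have "f absolutely_integrable_on {0<..<1}"
    by (rule set_integrable_subset) auto
  moreover have "integral {0<..<1} f = Beta (s / 2) (3 / 2)"
    using f01 by (simp add: has_integral_Icc_iff_Ioo integral_unique)
  moreover have "(\<lambda>x::real. x\<^sup>2) ` {0<..<1} = {0<..<1}"
  proof (intro equalityI subsetI)
    fix y :: real assume "y \<in> {0<..<1}"
    then show "y \<in> (\<lambda>x. x\<^sup>2) ` {0<..<1}"
      by (intro image_eqI[of _ _ "sqrt y"]) auto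
  qed (auto simp: power_less_one_iff)
  moreover have "inj_on (\<lambda>x::real. x\<^sup>2) {0<..<1}"
    by (auto simp: inj_on_def power2_eq_iff)
  ultimately have A: "(\<lambda>x. \<bar>2 * x\<bar> * f (x\<^sup>2)) absolutely_integrable_on {0<..<1}"
      "integral {0<..<1} (\<lambda>x. \<bar>2 * x\<bar> * f (x\<^sup>2)) = Beta (s / 2) (3 / 2)"
    using has_absolute_integral_change_of_variables_1'
      [of "{0<..<1::real}" "\<lambda>x. x\<^sup>2" "\<lambda>x. 2 * x" f "Beta (s / 2) (3 / 2)"]
    by (auto intro: DERIV_subset[OF DERIV_power[OF DERIV_ident, of 2, simplified]] derivative_eq_intros)
  then have "((\<lambda>x. \<bar>2 * x\<bar> * f (x\<^sup>2)) has_integral Beta (s / 2) (3 / 2)) {0<..<1}"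
    using set_lebesgue_integral_eq_integral(1) by (auto simp: has_integral_iff)
  from has_integral_divide[OF this, of 2]
  have "((\<lambda>x. x powr (s - 1) * (1 - x\<^sup>2) powr (1/2)) has_integral Beta (s / 2) (3 / 2) / 2) {0<..<1}"
  proof (rule has_integral_eq[rotated])
    fix x :: real assume x: "x \<in> {0<..<1}"
    \<comment> \<open>The division by 2 cancels the 2 of the Jacobian 2x; its factor x raises the
      exponent s - 2 to s - 1.\<close>
    have "(x\<^sup>2) powr (s / 2 - 1) = x powr (s - 2)"
      using x by (simp add: powr_powr right_diff_distrib flip: powr_numeral)
    then show "\<bar>2 * x\<bar> * f (x\<^sup>2) / 2 = x powr (s - 1) * (1 - x\<^sup>2) powr (1/2)"
      using x by (simp add: f_def powr_diff power2_eq_square)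
  qed
  then have "((\<lambda>x. complex_of_real (x powr (s - 1) * (1 - x\<^sup>2) powr (1/2))) has_integral
      of_real (Beta (s / 2) (3 / 2) / 2)) {0..1}"
    unfolding has_integral_Icc_iff_Ioo by (rule has_integral_of_real)
  then have "(mellin_integrand 0 (of_real s) has_integral of_real (Beta (s / 2) (3 / 2) / 2)) {0..1}"
  proof (rule has_integral_eq[rotated])
    fix x :: real assume "x \<in> {0..1}"
    then show "complex_of_real (x powr (s - 1) * (1 - x\<^sup>2) powr (1/2)) = mellin_integrand 0 (of_real s) x"
      using powr_of_real[of x "s - 1"] by (simp add: mellin_integrand_def chebyshev_T_0)
  qed
  then show ?thesis
    using mellin_integrand_has_integral[of "of_real s" 0] s by (intro has_integral_unique) auto
qed

text \<open>Away from 0, differentiation under the integral sign is available, so the integrals over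
  [\<open>a k\<close>, 1] are holomorphic. They converge locally uniformly as \<open>a k\<close>
  tends to 0, and the limit inherits holomorphy.\<close>

lemma mellin_integral_holomorphic:
  fixes g :: "real \<Rightarrow> complex"
  assumes g: "continuous_on {0..1} g"
  shows "(\<lambda>s. integral {0..1} (\<lambda>x. of_real x powr (s - 1) * g x)) holomorphic_on {s. Re s > 0}"
proof -
  define h where "h = (\<lambda>s x. complex_of_real x powr (s - 1) * g x)"
  define a where "a = (\<lambda>k. 1 / (real k + 1))"
  have a: "a k > 0" "a k \<le> 1" for k
    by (auto simp: a_def)
  have "bounded (g ` {0..1})"
    using g by (intro compact_imp_bounded compact_continuous_image) auto
  then obtain B where B: "\<And>x. x \<in> {0..1} \<Longrightarrow> norm (g x) \<le> B"
    unfolding bounded_iff by blast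
  have int: "h s integrable_on {0..1}" if "Re s > 0" for s
    using powr_continuous_absolutely_integrable[OF g that]
    by (simp add: h_def set_lebesgue_integral_eq_integral(1))
  have "(\<lambda>s. integral {0..1} (h s)) holomorphic_on {s. Re s > 0}"
  proof (rule holomorphic_uniform_sequence)
    fix k
    have sub: "cbox (a k) 1 \<subseteq> {0..1}"
      using a(1)[of k] by auto
    show "(\<lambda>s. integral (cbox (a k) 1) (h s)) holomorphic_on {s. Re s > 0}"
    proof (rule leibniz_rule_holomorphic)
      fix s :: complex and x :: real
      assume "s \<in> {s. Re s > 0}" "x \<in> cbox (a k) 1"
      then have "x > 0" using a(1)[of k] by auto
      then have "((\<lambda>s. of_real x powr (s - 1)) has_field_derivative
          Ln (of_real x) * of_real x powr (s - 1) * 1) (at s within {s. Re s > 0})"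
        by (intro DERIV_chain2[OF has_field_derivative_powr_right]) (auto intro!: derivative_eq_intros)
      then show "((\<lambda>s. h s x) has_field_derivative
          Ln (of_real x) * of_real x powr (s - 1) * 1 * g x) (at s within {s. Re s > 0})"
        unfolding h_def by (rule DERIV_cmult_right)
    next
      show "h s integrable_on cbox (a k) 1" if "s \<in> {s. Re s > 0}" for s
        using integrable_on_subinterval[OF int[of s], of "a k" 1] that sub by auto
    next
      have pos: "t > 0" if "a k \<le> t" for t
        using that a(1)[of k] by linarith
      show "continuous_on ({s. Re s > 0} \<times> cbox (a k) 1)
          (\<lambda>(s, x). Ln (of_real x) * of_real x powr (s - 1) * 1 * g x)"
        unfolding case_prod_unfold
        by (intro continuous_intros continuous_on_compose2[OF g]) (use a(1)[of k] sub in \<open>auto dest!: pos\<close>)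
    qed (rule convex_halfspace_Re_gt)
  next
    fix z assume z: "z \<in> {s. Re s > 0}"
    \<comment> \<open>Half of Re z serves both as the radius and as a lower bound: Re s >= d > 0 on
      the closed ball.\<close>
    define d where "d = Re z / 2"
    have d: "d > 0" using z by (simp add: d_def)
    have Re: "Re s \<ge> d" if "s \<in> cball z d" for s
      using abs_Re_le_cmod[of "z - s"] that by (simp add: d_def dist_norm)
    have "uniform_limit (cball z d) (\<lambda>k s. integral (cbox (a k) 1) (h s))
        (\<lambda>s. integral {0..1} (h s)) sequentially"
    proof (rule uniform_limitI)
      fix e :: real assume "e > 0"
      have "a \<longlonglongrightarrow> 0"
        unfolding a_def using LIMSEQ_inverse_real_of_nat by (simp add: inverse_eq_divide add.commute)
      \<comment> \<open>This bounds the missing piece: it is the integral of B x^(d - 1) over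
        [0, \<open>a k\<close>]. Its independence of s gives uniformity.\<close>
      then have "(\<lambda>k. a k powr d / d * B) \<longlonglongrightarrow> 0 powr d / d * B"
        using d a(1) by (intro tendsto_intros tendsto_powr') (auto intro: always_eventually less_imp_le)
      then have "\<forall>\<^sub>F k in sequentially. a k powr d / d * B < e"
        using \<open>e > 0\<close> d by (intro order_tendstoD(2)) auto
      then show "\<forall>\<^sub>F k in sequentially. \<forall>s\<in>cball z d.
          dist (integral (cbox (a k) 1) (h s)) (integral {0..1} (h s)) < e"
      proof (eventually_elim, intro ballI)
        fix k s assume k: "a k powr d / d * B < e" and s: "s \<in> cball z d"
        have s0: "Re s > 0" using Re[OF s] d by simp
        have "integral {0..1} (h s) = integral {0..a k} (h s) + integral {a k..1} (h s)"
          using a[of k] int[OF s0] by (simp add: Henstock_Kurzweil_Integration.integral_combine)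
        then have "dist (integral (cbox (a k) 1) (h s)) (integral {0..1} (h s)) =
            norm (integral {0..a k} (h s))"
          by (simp add: dist_norm)
        also have "\<dots> \<le> a k powr d / d * B"
        proof -
          have P: "((\<lambda>x. x powr (d - 1) * B) has_integral a k powr d / d * B) {0..a k}"
            using has_integral_powr_from_0[of "d - 1" "a k"] d a(1)[of k]
            by (intro has_integral_mult_left) auto
          have "norm (h s x) \<le> x powr (d - 1) * B" if "x \<in> {0..a k}" for x
          proof -
            have x: "0 \<le> x" "x \<le> 1" using that a[of k] by auto
            then have "x powr (Re s - 1) \<le> x powr (d - 1)"
              using Re[OF s] by (cases "x = 0") (auto intro!: powr_mono')
            then show ?thesis
              using B[of x] x unfolding h_def
              by (cases "x = 0") (auto simp: norm_mult norm_powr_real_powr intro!: mult_mono)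
          qed
          moreover have "h s integrable_on {0..a k}"
            using a[of k] by (intro integrable_on_subinterval[OF int[OF s0]]) auto
          ultimately show ?thesis
            using integral_norm_bound_integral[of "h s" "{0..a k}" "\<lambda>x. x powr (d - 1) * B"] P
            by (auto simp: has_integral_iff)
        qed
        finally show "dist (integral (cbox (a k) 1) (h s)) (integral {0..1} (h s)) < e"
          using k by simp
      qed
    qed
    moreover have "cball z d \<subseteq> {s. Re s > 0}"
      using Re d by force
    ultimately show "\<exists>d>0. cball z d \<subseteq> {s. Re s > 0} \<and>
        uniform_limit (cball z d) (\<lambda>k s. integral (cbox (a k) 1) (h s))
        (\<lambda>s. integral {0..1} (h s)) sequentially"
      using d by blast
  qed (rule open_halfspace_Re_gt)
  then show ?thesis
    by (simp add: h_def)
qed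

lemma Re_pos_not_nonpos_Int: "Re z > 0 \<Longrightarrow> z \<notin> \<int>\<^sub>\<le>\<^sub>0"
  by (auto elim!: nonpos_Ints_cases)

text \<open>Identity theorem: both sides are holomorphic on the connected right half-plane and agree
  on the positive reals, which accumulate at 1.\<close>

lemma mellin_T_0:
  assumes s: "Re s > 0"
  shows "mellin_T 0 s = Beta (s / 2) (3 / 2) / 2"
proof -
  define f where "f = (\<lambda>s. mellin_T 0 s - Beta (s / 2) (3 / 2) / 2)"
  have m: "mellin_T 0 holomorphic_on {s. Re s > 0}"
    unfolding mellin_T_def chebyshev_T_0
    by (intro mellin_integral_holomorphic continuous_intros continuous_on_powr') (auto simp: power_le_one)
  have "f s = 0"
  proof (rule analytic_continuation[of f "{s. Re s > 0}" "of_real ` {0<..}" 1])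
    show "f holomorphic_on {s. Re s > 0}"
      unfolding f_def Beta_def
      by (intro holomorphic_intros m) (auto simp: Re_pos_not_nonpos_Int Gamma_eq_zero_iff)
    show "(1::complex) islimpt of_real ` {0<..}"
      unfolding islimpt_approachable
    proof (intro allI impI)
      fix e :: real assume "e > 0"
      then show "\<exists>x'\<in>of_real ` {0<..}. x' \<noteq> (1::complex) \<and> dist x' 1 < e"
        by (intro bexI[of _ "of_real (1 + e / 2)"] imageI) (auto simp: dist_norm)
    qed
    show "f z = 0" if "z \<in> of_real ` {0<..}" for z
      using that by (auto simp: f_def mellin_T_0_real simp flip: Beta_complex_of_real)
    show "connected {s. Re s > 0}"
      by (intro convex_connected convex_halfspace_Re_gt)
  qed (use s in \<open>auto simp: open_halfspace_Re_gt\<close>)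
  then show ?thesis by (simp add: f_def)
qed

section \<open>The normalised functions and their recurrence\<close>

text \<open>Written with Gamma functions, the Beta value is Gamma(s/2) Gamma(3/2) / Gamma((s +
  3)/2); the normalisation cancels both factors that depend on s.\<close>

lemma p_T_0:
  assumes "Re s > 0" shows "p_T 0 s = Gamma (3/2) / 2"
  using assms by (simp add: p_T_def parity_eps_def mellin_T_0 Beta_def add_divide_distrib
      Gamma_eq_zero_iff Re_pos_not_nonpos_Int)

text \<open>The argument s + 1 in M_1(s) = M_0(s + 1) is matched by \<open>parity_eps\<close> = 1,
  so the cancellation is the same as for n = 0.\<close>

lemma p_T_1:
  assumes "Re s > 0" shows "p_T 1 s = Gamma (3/2) / 2"
proof -
  have "Gamma ((s + of_nat 1 + 3) / 2) = Gamma ((s + 1) / 2 + 3 / 2)"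
    by (rule arg_cong[where f = Gamma]) (simp add: field_simps)
  moreover have "Gamma ((s + 1) / 2) \<noteq> 0" "Gamma ((s + 1) / 2 + 3 / 2) \<noteq> 0"
    using assms by (simp_all only: Gamma_eq_zero_iff) (auto intro!: Re_pos_not_nonpos_Int add_pos_pos)
  ultimately show ?thesis
    using assms unfolding p_T_def by (simp add: parity_eps_def mellin_T_1[simplified] mellin_T_0 Beta_def)
qed

text \<open>In the numerators, Gamma((s + n + 5)/2) exceeds Gamma((s + n + 3)/2) by the factor (s +
  n + 3)/2. For even n the shifted term is divided by Gamma((s + 2)/2) = (s/2) Gamma(s/2), which
  turns the coefficient 2 into s; for odd n all denominators are Gamma((s + 1)/2).\<close>

lemma p_T_rec:
  assumes s: "Re s > 0"
  shows "p_T (n + 2) s = (if even n then s else 2) * p_T (n + 1) (s + 1)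
           - (s + of_nat n + 3) / 2 * p_T n s"
proof -
  have G: "Gamma (z + 1) = z * Gamma z" if "Re z > 0" for z :: complex
    using that by (intro Gamma_plus1) (auto simp: Re_pos_not_nonpos_Int)
  have *: "Gamma ((s + of_nat n + 5) / 2) = (s + of_nat n + 3) / 2 * Gamma ((s + of_nat n + 3) / 2)"
    using G[of "(s + of_nat n + 3) / 2"] s by (simp add: add_divide_distrib add_ac)
  have **: "Gamma ((s + 2) / 2) = s / 2 * Gamma (s / 2)"
    using G[of "s / 2"] s by (simp add: add_divide_distrib)
  have nz: "Gamma (s / 2) \<noteq> 0" "Gamma ((s + 1) / 2) \<noteq> 0" "s \<noteq> 0"
    using s by (auto simp: Gamma_eq_zero_iff Re_pos_not_nonpos_Int)
  have e: "s + of_nat (n + 2) + 3 = s + of_nat n + 5" "s + 1 + of_nat (n + 1) + 3 = s + of_nat n + 5"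
    "s + 1 + 1 = s + 2"
    by simp_all
  show ?thesis
    unfolding p_T_def mellin_T_rec[OF s] e *
    using nz by (cases "even n") (simp_all add: parity_eps_def ** e field_simps)
qed

section \<open>Factorisation by induction\<close>

text \<open>What is left of the recurrence at index N once common factors are removed: the root of
  the form N^2 - 1 reappears for N + 2, together with one new trivial zero N - 1 = (N + 2) -
  3.\<close>

lemma p_T_rec_identity:
  fixes s N :: complex
  shows "s * (s + 1 - ((N + 1)\<^sup>2 - 1)) - (s + N + 3) / 2 * (s - (N\<^sup>2 - 1)) =
         (s - ((N + 2)\<^sup>2 - 1)) * (s - (N - 1)) / 2"
  by (simp add: power2_eq_square field_simps)

text \<open>The parities are treated together because the recurrence mixes them, and for all s at
  once because it evaluates at s + 1. The exponent m + 1 counts the steps of two from p_0 = p_1 =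
  \<open>c\<close>, each halving the constant.\<close>

lemma p_T_even_odd:
  assumes "Re s > 0"
  defines "c \<equiv> Gamma (3/2) / 2 :: complex"
  shows "p_T (2 * m + 2) s = c / 2 ^ (m + 1) * (s - (of_nat (2 * m + 2) ^ 2 - 1)) *
           (\<Prod>j<m. s - of_nat (2 * j + 1)) \<and>
         p_T (2 * m + 3) s = c / 2 ^ (m + 1) * (s - (of_nat (2 * m + 3) ^ 2 - 1)) *
           (\<Prod>j<m. s - of_nat (2 * j + 2))"
  using assms(1)
proof (induction m arbitrary: s)
  case 0
  then have 2: "p_T 2 s = c / 2 * (s - 3)" if "Re s > 0" for s
  proof -
    have "p_T 2 s = s * p_T 1 (s + 1) - (s + 3) / 2 * p_T 0 s"
      using p_T_rec[OF that, of 0] by (simp add: numeral_2_eq_2)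
    moreover have "p_T 1 (s + 1) = c" "p_T 0 s = c"
      using p_T_1[of "s + 1"] p_T_0[OF that] that by (simp_all add: c_def)
    ultimately show ?thesis
      by (simp only:) (simp add: field_simps)
  qed
  have "p_T 3 s = 2 * p_T 2 (s + 1) - (s + 4) / 2 * p_T 1 s"
    using p_T_rec[of s 1] 0 by (simp add: numeral_3_eq_3 numeral_2_eq_2 add.commute)
  moreover have "p_T 2 (s + 1) = c / 2 * (s - 2)" "p_T 1 s = c"
    using 0 2[of "s + 1"] p_T_1[of s] by (simp_all add: c_def)
  ultimately have "p_T 3 s = c / 2 * (s - 8)"
    by (simp only:) (simp add: field_simps)
  moreover have "2 * 0 + 2 = (2::nat)" "2 * 0 + 3 = (3::nat)"
    by simp_all
  ultimately show ?case
    using 2[OF 0] by (simp only:) simp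
next
  case (Suc m)
  define U where "U = (\<lambda>s::complex. \<Prod>j<m. s - of_nat (2 * j + 1))"
  define V where "V = (\<lambda>s::complex. \<Prod>j<m. s - of_nat (2 * j + 2))"
  \<comment> \<open>The even zeros 2, 4, ... move to the odd ones, and the odd zeros 1, 3, ... move
    to 0, 2, 4, ...; the zero at 0 supplies the factor s.\<close>
  have shift: "V (s + 1) = U s" "(\<Prod>j<Suc m. s + 1 - of_nat (2 * j + 1)) = s * V s" for s
    by (simp_all add: U_def V_def prod.lessThan_Suc_shift algebra_simps del: prod.lessThan_Suc)
  define D where "D = c / 2 ^ (m + 1)"
  \<comment> \<open>Here \<open>e\<close> is the common product of trivial zeros and
    \<open>a\<close> will be s. In the second form \<open>a\<close> comes from the shifted product,
    and the coefficient 2 cancels the halved constant.\<close>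
  have factor: "a * (D * u * e) - r * (D * v * e) = D * e * (a * u - r * v)"
    and factor_half: "2 * (D / 2 * u * (a * e)) - r * (D * v * e) = D * e * (a * u - r * v)"
    for a u e r v
    by (simp_all add: algebra_simps)
  have D: "c / 2 ^ (Suc m + 1) = D / 2"
    by (simp add: D_def)
  \<comment> \<open>Kept general in s, since the odd case below uses it at s + 1.\<close>
  have Even: "p_T (2 * Suc m + 2) s = c / 2 ^ (Suc m + 1) *
      (s - (of_nat (2 * Suc m + 2) ^ 2 - 1)) * (\<Prod>j<Suc m. s - of_nat (2 * j + 1))"
    if s: "Re s > 0" for s
  proof -
    define N :: complex where "N = of_nat (2 * m + 2)"
    have N: "of_nat (2 * m + 3) = N + 1" "of_nat (2 * Suc m + 2) = N + 2"
      "of_nat (2 * m + 1) = N - 1"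
      by (simp_all add: N_def)
    have "2 * m + 2 + 2 = 2 * Suc m + 2" "2 * m + 2 + 1 = 2 * m + 3" "even (2 * m + 2)"
      by simp_all
    with p_T_rec[OF s, of "2 * m + 2"]
    have "p_T (2 * Suc m + 2) s = s * p_T (2 * m + 3) (s + 1) - (s + N + 3) / 2 * p_T (2 * m + 2) s"
      by (simp only: N_def if_True)
    also have "p_T (2 * m + 3) (s + 1) = D * (s + 1 - ((N + 1)\<^sup>2 - 1)) * U s"
      using Suc.IH[of "s + 1"] s unfolding shift(1)[symmetric] V_def D_def N by simp
    also have "p_T (2 * m + 2) s = D * (s - (N\<^sup>2 - 1)) * U s"
      using Suc.IH[of s] s unfolding U_def D_def N_def by simp
    also have "s * (D * (s + 1 - ((N + 1)\<^sup>2 - 1)) * U s) - (s + N + 3) / 2 * (D * (s - (N\<^sup>2 - 1)) * U s) =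
        D * U s * (s * (s + 1 - ((N + 1)\<^sup>2 - 1)) - (s + N + 3) / 2 * (s - (N\<^sup>2 - 1)))"
      by (rule factor)
    also have "\<dots> = D / 2 * (s - ((N + 2)\<^sup>2 - 1)) * (U s * (s - (N - 1)))"
      unfolding p_T_rec_identity by simp
    finally show ?thesis
      unfolding D prod.lessThan_Suc N U_def .
  qed
  define N :: complex where "N = of_nat (2 * m + 3)"
  have N: "of_nat (2 * Suc m + 2) = N + 1" "of_nat (2 * Suc m + 3) = N + 2"
    "of_nat (2 * m + 2) = N - 1"
    by (simp_all add: N_def)
  have "2 * m + 3 + 2 = 2 * Suc m + 3" "2 * m + 3 + 1 = 2 * Suc m + 2" "odd (2 * m + 3)"
    by simp_all
  with p_T_rec[OF Suc.prems, of "2 * m + 3"]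
  have "p_T (2 * Suc m + 3) s = 2 * p_T (2 * Suc m + 2) (s + 1) - (s + N + 3) / 2 * p_T (2 * m + 3) s"
    by (simp only: N_def if_False)
  also have "p_T (2 * Suc m + 2) (s + 1) = D / 2 * (s + 1 - ((N + 1)\<^sup>2 - 1)) * (s * V s)"
    using Even[of "s + 1"] Suc.prems unfolding shift D N by simp
  also have "p_T (2 * m + 3) s = D * (s - (N\<^sup>2 - 1)) * V s"
    using Suc.IH[OF Suc.prems] unfolding V_def D_def N_def by simp
  also have "2 * (D / 2 * (s + 1 - ((N + 1)\<^sup>2 - 1)) * (s * V s)) - (s + N + 3) / 2 * (D * (s - (N\<^sup>2 - 1)) * V s) =
      D * V s * (s * (s + 1 - ((N + 1)\<^sup>2 - 1)) - (s + N + 3) / 2 * (s - (N\<^sup>2 - 1)))"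
    by (rule factor_half)
  also have "\<dots> = D / 2 * (s - ((N + 2)\<^sup>2 - 1)) * (V s * (s - (N - 1)))"
    unfolding p_T_rec_identity by simp
  finally have "p_T (2 * Suc m + 3) s = c / 2 ^ (Suc m + 1) *
      (s - (of_nat (2 * Suc m + 3) ^ 2 - 1)) * (\<Prod>j<Suc m. s - of_nat (2 * j + 2))"
    unfolding D prod.lessThan_Suc N V_def .
  with Even[OF Suc.prems] show ?case by blast
qed

theorem theorem7:
  fixes n :: nat
  assumes "n \<ge> 2"
  shows "\<exists>P :: complex poly.
           (\<forall>s. Re s > 0 \<longrightarrow> p_T n s = poly P s) \<and>
           (odd n \<longrightarrow> {s. poly P s = 0} =
              {of_nat k | k. even k \<and> 2 \<le> k \<and> k + 3 \<le> n} \<union> {of_nat n ^ 2 - 1}) \<and>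
           (even n \<longrightarrow> {s. poly P s = 0} =
              {of_nat k | k. odd k \<and> 1 \<le> k \<and> k + 3 \<le> n} \<union> {of_nat n ^ 2 - 1})"
proof -
  \<comment> \<open>The number of trivial zeros; it is 0 for n = 2 and n = 3, where the product is
    empty.\<close>
  define m where "m = n div 2 - 1"
  define P :: "complex poly" where
    "P = smult (Gamma (3/2) / 2 / 2 ^ (m + 1)) ([:- (of_nat n ^ 2 - 1), 1:] *
           (\<Prod>j<m. [:- of_nat (if even n then 2 * j + 1 else 2 * j + 2), 1:]))"
  have n: "n = (if even n then 2 * m + 2 else 2 * m + 3)"
    unfolding m_def using assms by presburger
  have poly_P: "poly P s = Gamma (3/2) / 2 / 2 ^ (m + 1) * (s - (of_nat n ^ 2 - 1)) *
      (\<Prod>j<m. s - of_nat (if even n then 2 * j + 1 else 2 * j + 2))" for s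
  proof -
    have "poly [:- a, 1:] s = s - a" for a :: complex
      by simp
    then show ?thesis
      unfolding P_def poly_smult poly_mult poly_prod by (simp only: mult.assoc)
  qed
  have "p_T n s = poly P s" if "Re s > 0" for s
  proof (cases "even n")
    case True
    with n have n': "2 * m + 2 = n" by simp
    from p_T_even_odd[OF that, of m] show ?thesis
      unfolding n' by (simp only: poly_P True if_True)
  next
    case False
    with n have n': "2 * m + 3 = n" by simp
    from p_T_even_odd[OF that, of m] show ?thesis
      unfolding n' by (simp only: poly_P False if_False)
  qed
  \<comment> \<open>The leading constant is nonzero, so every root comes from a linear
    factor.\<close>
  moreover have "Gamma (3/2 :: complex) \<noteq> 0"
    by (simp add: Gamma_eq_zero_iff Re_pos_not_nonpos_Int)
  then have "poly P s = 0 \<longleftrightarrow> s = of_nat n ^ 2 - 1 \<or>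
      (\<exists>j<m. s = of_nat (if even n then 2 * j + 1 else 2 * j + 2))" for s
    unfolding poly_P
    by (simp only: mult_eq_0_iff prod_zero_iff right_minus_eq divide_eq_0_iff power_eq_0_iff
        finite_lessThan) auto
  moreover have "(\<exists>j<m. s = of_nat (2 * j + 1)) \<longleftrightarrow>
      (\<exists>k. s = of_nat k \<and> odd k \<and> 1 \<le> k \<and> k + 3 \<le> n)" if "even n" for s :: complex
  proof -
    \<comment> \<open>With n = 2m + 2 and k = 2j + 1, the bound k + 3 <= n says exactly j <
      m.\<close>
    have "(\<exists>j<m. k = 2 * j + 1) \<longleftrightarrow> odd k \<and> 1 \<le> k \<and> k + 3 \<le> n" for k
      using n that by (auto elim!: oddE)
    then show ?thesis by metis
  qed
  moreover have "(\<exists>j<m. s = of_nat (2 * j + 2)) \<longleftrightarrow>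
      (\<exists>k. s = of_nat k \<and> even k \<and> 2 \<le> k \<and> k + 3 \<le> n)" if "odd n" for s :: complex
  proof -
    \<comment> \<open>Now n = 2m + 3 and k = 2j + 2, and k + 3 <= n is again equivalent to j <
      m.\<close>
    have "(\<exists>j<m. k = 2 * j + 2) \<longleftrightarrow> even k \<and> 2 \<le> k \<and> k + 3 \<le> n" for k
      using n that by presburger
    then show ?thesis by metis
  qed
  ultimately show ?thesis
    by (intro exI[of _ P]) auto
qed

end
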